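(* The weak monadic second order theory of the structure $(\mathbb{Q},<)$ is first order interpretable in the monoid $M$ of order-embeddings of $(\mathbb{Q},<)$ into itself (under composition), and also in the monoid $E$ of endomorphisms of $(\mathbb{Q},<)$ (under composition).
   Context: The weak monadic second order theory of a structure is the set of second order sentences true in it where second order quantification ranges only over finite subsets of the domain. The monoids are considered as first-order structures in the language with a binary operation $\circ$ (composition). *)

theory Defs
  imports Complex_Main
begin

datatype fterm = V nat | Comp fterm fterm

datatype fform = Eq fterm fterm | Neg fform | Conj fform fform | Ex nat fform

primrec evalt :: "('a \<Rightarrow> 'a \<Rightarrow> 'a) \<Rightarrow> (nat \<Rightarrow> 'a) \<Rightarrow> fterm \<Rightarrow> 'a" where
  "evalt f \<rho> (V i) = \<rho> i"
| "evalt f \<rho> (Comp s t) = f (evalt f \<rho> s) (evalt f \<rho> t)"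

primrec sat :: "'a set \<Rightarrow> ('a \<Rightarrow> 'a \<Rightarrow> 'a) \<Rightarrow> (nat \<Rightarrow> 'a) \<Rightarrow> fform \<Rightarrow> bool" where
  "sat A f \<rho> (Eq s t) = (evalt f \<rho> s = evalt f \<rho> t)"
| "sat A f \<rho> (Neg \<phi>) = (\<not> sat A f \<rho> \<phi>)"
| "sat A f \<rho> (Conj \<phi> \<psi>) = (sat A f \<rho> \<phi> \<and> sat A f \<rho> \<psi>)"
| "sat A f \<rho> (Ex i \<phi>) = (\<exists>a\<in>A. sat A f (\<rho>(i := a)) \<phi>)"

text \<open>A formula holds of a tuple xs when the variables 0,...,length xs - 1 are
  assigned the entries of xs (any further free variables are read universally,
  i.e. the universal closure over the remaining variables is taken).\<close>
definition holds :: "'a set \<Rightarrow> ('a \<Rightarrow> 'a \<Rightarrow> 'a) \<Rightarrow> fform \<Rightarrow> 'a list \<Rightarrow> bool" where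
  "holds A f \<phi> xs \<longleftrightarrow>
     (\<forall>\<rho>. (\<forall>i. \<rho> i \<in> A) \<longrightarrow> (\<forall>i<length xs. \<rho> i = xs ! i) \<longrightarrow> sat A f \<rho> \<phi>)"

definition tuples :: "'a set \<Rightarrow> nat \<Rightarrow> 'a list set" where
  "tuples A n = {xs. set xs \<subseteq> A \<and> length xs = n}"

text \<open>The WMSO theory of (Q,<) is the theory of the two-sorted structure
  (Q, finite subsets of Q; <, \<in>).  A (multi-dimensional, parameter-free) first-order
  interpretation of this structure in (A, f) consists of dimensions nP, nS, domain
  formulas dP, dS, equivalence formulas eqP, eqS, formulas lt, mem interpreting
  < and \<in>, and coordinate maps cP, cS onto Q resp. the finite subsets of Q whose
  kernels are defined by eqP, eqS and which carry lt, mem to <, \<in>.\<close>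
definition wmso_Q_interpretable :: "'a set \<Rightarrow> ('a \<Rightarrow> 'a \<Rightarrow> 'a) \<Rightarrow> bool" where
  "wmso_Q_interpretable A f \<longleftrightarrow>
    (\<exists>(nP::nat) (nS::nat) dP dS eqP eqS lt mem
       (cP :: 'a list \<Rightarrow> rat) (cS :: 'a list \<Rightarrow> rat set).
      let DP = {xs \<in> tuples A nP. holds A f dP xs};
          DS = {zs \<in> tuples A nS. holds A f dS zs} in
      cP ` DP = UNIV \<and>
      cS ` DS = {X. finite X} \<and>
      (\<forall>xs\<in>DP. \<forall>ys\<in>DP. holds A f eqP (xs @ ys) \<longleftrightarrow> cP xs = cP ys) \<and>
      (\<forall>zs\<in>DS. \<forall>ws\<in>DS. holds A f eqS (zs @ ws) \<longleftrightarrow> cS zs = cS ws) \<and>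
      (\<forall>xs\<in>DP. \<forall>ys\<in>DP. holds A f lt (xs @ ys) \<longleftrightarrow> cP xs < cP ys) \<and>
      (\<forall>xs\<in>DP. \<forall>zs\<in>DS. holds A f mem (xs @ zs) \<longleftrightarrow> cP xs \<in> cS zs))"

definition embQ :: "(rat \<Rightarrow> rat) set" where
  "embQ = {g. \<forall>x y. x < y \<longleftrightarrow> g x < g y}"

definition endQ :: "(rat \<Rightarrow> rat) set" where
  "endQ = {g. \<forall>x y. x \<le> y \<longrightarrow> g x \<le> g y}"

end

theory Submission
  imports Defs
begin

text \<open>Both monoids contain the strictly monotone maps and consist of monotone ones, and this is
  all that is used. A unit t is conjugate, by an order automorphism or an order-reversing
  bijection, to x + 1 iff it can be semiconjugated into every unit s other than the identity or
  into its inverse. The double centralizer of such a t is the set of powers of t, and a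
  semiconjugacy h with h t = t^a h satisfies h t^b = t^(a b) h, so the exponents carry a definable
  ring structure; a semiconjugacy of t into t' or its inverse identifies exponents for different
  choices of t. Rationals are then fractions of exponents, and finite sets of rationals are coded
  by finitely many exponents through the beta function.\<close>

subsection \<open>Order automorphisms of the rationals and translations\<close>

text \<open>Conjugation by negation, g |-> -g(-x), is an automorphism of either monoid and exchanges
  x + 1 with x - 1. No formula can therefore fix an orientation of the line, and every defined
  notion has to be symmetric under reversal: hence the order-reversing charts and the alternatives
  with an inverse. Likewise no shift is fixed by conjugation with all order automorphisms, so none
  is definable without parameters. Each code of a point or of a set carries its own shift, and only
  exponents, which survive these conjugations, can be compared between codes. The units s in the
  criterion for t may have fixed points; this is why a semiconjugacy, possibly with bounded range,
  takes the place of a conjugacy.\<close>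

definition autQ :: "(rat \<Rightarrow> rat) set" where
  "autQ = {g. bij g \<and> strict_mono g}"

text \<open>Order automorphisms are included along with the reversing bijections. Reversal is
  phrased through precomposition with negation, so that the reversing case reduces to the increasing
  one.\<close>

definition anti_autQ :: "(rat \<Rightarrow> rat) set" where
  "anti_autQ = {g. bij g \<and> (strict_mono g \<or> strict_mono (\<lambda>x. g (- x)))}"

lemma embQ_iff: "g \<in> embQ \<longleftrightarrow> strict_mono g"
  unfolding embQ_def strict_mono_def mem_Collect_eq
  by (metis linorder_neqE_linordered_idom order.asym order.irrefl)

lemma endQ_iff: "g \<in> endQ \<longleftrightarrow> mono g"
  by (auto simp: endQ_def mono_def)

lemma autQ_anti_autQ: "g \<in> autQ \<Longrightarrow> g \<in> anti_autQ"
  by (simp add: autQ_def anti_autQ_def)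

lemma autQ_embQ: "g \<in> autQ \<Longrightarrow> g \<in> embQ"
  by (simp add: autQ_def embQ_iff)

lemma strict_mono_inv_rat:
  fixes g :: "rat \<Rightarrow> rat"
  assumes "bij g" "strict_mono g"
  shows "strict_mono (inv g)"
  by (metis assms bij_inv_eq_iff strict_mono_less strict_mono_def)

lemma autQ_inv: "g \<in> autQ \<Longrightarrow> inv g \<in> autQ"
  by (simp add: autQ_def bij_imp_bij_inv strict_mono_inv_rat)

lemma autQ_comp: "g \<in> autQ \<Longrightarrow> h \<in> autQ \<Longrightarrow> g \<circ> h \<in> autQ"
  by (auto simp: autQ_def bij_comp strict_mono_def)

lemma bij_uminus_rat: "bij (uminus :: rat \<Rightarrow> rat)"
  by (rule bijI') (auto intro: exI[of _ "- _"])

lemma inv_uminus_rat: "inv (uminus :: rat \<Rightarrow> rat) = uminus"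
  by (rule inv_unique_comp) auto

lemma anti_autQ_uminus:
  assumes "g \<in> anti_autQ" shows "g \<circ> uminus \<in> anti_autQ"
  using assms bij_comp[OF bij_uminus_rat, of g] unfolding anti_autQ_def by (auto simp: o_def)

lemma anti_autQ_cases:
  assumes "g \<in> anti_autQ"
  obtains "g \<in> autQ" | "g \<circ> uminus \<in> autQ"
  using assms bij_comp[OF bij_uminus_rat, of g] unfolding anti_autQ_def autQ_def
  by (auto simp: o_def)

lemma anti_autQ_bij: "g \<in> anti_autQ \<Longrightarrow> bij g"
  by (simp add: anti_autQ_def)

section \<open>Translations read in an arbitrary coordinate of the line\<close>

definition conjQ :: "(rat \<Rightarrow> rat) \<Rightarrow> (rat \<Rightarrow> rat) \<Rightarrow> rat \<Rightarrow> rat" where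
  "conjQ \<phi> g = \<phi> \<circ> g \<circ> inv \<phi>"

lemma conjQ_comp: "bij \<phi> \<Longrightarrow> conjQ \<phi> g \<circ> conjQ \<phi> h = conjQ \<phi> (g \<circ> h)"
  by (auto simp: conjQ_def fun_eq_iff bij_is_inj)

lemma conjQ_id: "bij \<phi> \<Longrightarrow> conjQ \<phi> (\<lambda>x. x) = id"
  by (auto simp: conjQ_def fun_eq_iff bij_is_surj surj_f_inv_f)

lemma conjQ_inj: "bij \<phi> \<Longrightarrow> conjQ \<phi> g = conjQ \<phi> h \<longleftrightarrow> g = h"
  unfolding conjQ_def fun_eq_iff o_def by (metis bij_inv_eq_iff)

text \<open>For a reversing \<phi> the two reversals cancel: \<phi> is made increasing by negating
  its argument, and g is replaced by -g(-x), which is again increasing.\<close>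

lemma conjQ_strict_mono:
  assumes \<phi>: "\<phi> \<in> anti_autQ" and g: "strict_mono g"
  shows "strict_mono (conjQ \<phi> g)"
proof -
  have *: "strict_mono (conjQ \<phi> g)" if \<phi>: "\<phi> \<in> autQ" and g: "strict_mono g" for \<phi> g
    using autQ_inv[OF \<phi>] \<phi> g unfolding conjQ_def autQ_def strict_mono_def by auto
  show ?thesis using \<phi>
  proof (cases rule: anti_autQ_cases)
    case 1
    then show ?thesis using * g by blast
  next
    case 2
    have "conjQ (\<phi> \<circ> uminus) (\<lambda>x. - g (- x)) = conjQ \<phi> g"
      using anti_autQ_bij[OF \<phi>] bij_uminus_rat
      by (auto simp: conjQ_def fun_eq_iff o_inv_distrib inv_uminus_rat)
    moreover have "strict_mono (\<lambda>x. - g (- x))" using g by (auto simp: strict_mono_def)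
    ultimately show ?thesis using *[OF 2] by metis
  qed
qed

lemma conjQ_autQ:
  assumes "\<phi> \<in> anti_autQ" "g \<in> autQ" shows "conjQ \<phi> g \<in> autQ"
  using assms conjQ_strict_mono[OF assms(1)] unfolding autQ_def
  by (auto simp: conjQ_def anti_autQ_bij intro!: bij_comp bij_imp_bij_inv)

definition transl :: "(rat \<Rightarrow> rat) \<Rightarrow> rat \<Rightarrow> rat \<Rightarrow> rat" where
  "transl \<phi> q = conjQ \<phi> (\<lambda>x. x + q)"

lemma shift_autQ: "(\<lambda>x. x + q) \<in> autQ"
  by (auto simp: autQ_def strict_mono_def intro!: bijI' exI[of _ "_ - q"])

lemma scale_autQ: "q > 0 \<Longrightarrow> (\<lambda>x. q * x) \<in> autQ"
  by (auto simp: autQ_def strict_mono_def intro!: bijI' exI[of _ "_ / q"])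

lemma transl_autQ: "\<phi> \<in> anti_autQ \<Longrightarrow> transl \<phi> q \<in> autQ"
  by (simp add: transl_def conjQ_autQ shift_autQ)

lemma transl_comp: "\<phi> \<in> anti_autQ \<Longrightarrow> transl \<phi> p \<circ> transl \<phi> q = transl \<phi> (p + q)"
  unfolding transl_def by (simp add: conjQ_comp anti_autQ_bij) (simp add: o_def add_ac)

lemma transl_0: "\<phi> \<in> anti_autQ \<Longrightarrow> transl \<phi> 0 = id"
  by (simp add: transl_def conjQ_id anti_autQ_bij)

lemma transl_apply_inj:
  assumes "\<phi> \<in> anti_autQ" shows "transl \<phi> p x = transl \<phi> q x \<longleftrightarrow> p = q"
  using bij_is_inj[OF anti_autQ_bij[OF assms]] by (auto simp: transl_def conjQ_def inj_eq)

lemma transl_inj: "\<phi> \<in> anti_autQ \<Longrightarrow> transl \<phi> p = transl \<phi> q \<longleftrightarrow> p = q"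
  using transl_apply_inj by metis

text \<open>Negating the coordinate inverts the translation. Consequently the inverse of a shift is
  a shift.\<close>

lemma transl_uminus:
  assumes "\<phi> \<in> anti_autQ" shows "transl (\<phi> \<circ> uminus) q = transl \<phi> (- q)"
  using anti_autQ_bij[OF assms] bij_uminus_rat
  by (auto simp: transl_def conjQ_def fun_eq_iff o_inv_distrib inv_uminus_rat algebra_simps)

text \<open>A semiconjugacy of generators extends to all integer powers. With \<psi> = \<phi> and q
  = a this is the multiplication of exponents; with two charts and q = 1 or q = -1 it compares
  exponents of different shifts.\<close>

lemma semiconj_transl:
  assumes \<phi>: "\<phi> \<in> anti_autQ" and \<psi>: "\<psi> \<in> anti_autQ"
    and h: "h \<circ> transl \<phi> 1 = transl \<psi> q \<circ> h"
  shows "h \<circ> transl \<phi> (of_int n) = transl \<psi> (of_int n * q) \<circ> h"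
proof (induction n rule: int_induct[where k = 0])
  case base
  show ?case by (simp add: transl_0 \<phi> \<psi>)
next
  case (step1 i)
  have "h \<circ> transl \<phi> (of_int (i + 1)) = (h \<circ> transl \<phi> (of_int i)) \<circ> transl \<phi> 1"
    by (simp add: comp_assoc transl_comp \<phi>)
  also have "\<dots> = transl \<psi> (of_int i * q) \<circ> (h \<circ> transl \<phi> 1)"
    using step1(2) by (simp only: comp_assoc)
  also have "\<dots> = (transl \<psi> (of_int i * q) \<circ> transl \<psi> q) \<circ> h"
    by (simp add: h comp_assoc)
  finally show ?case by (simp add: transl_comp \<psi> algebra_simps)
next
  case (step2 i)
  \<comment> \<open>Downward step: h may fail to be invertible, so the missing factor
    \<open>transl \<psi> q\<close> is put in front on the left and cancelled there by its
    inverse.\<close>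
  have "transl \<psi> q \<circ> (h \<circ> transl \<phi> (of_int (i - 1))) = (h \<circ> transl \<phi> 1) \<circ> transl \<phi> (of_int (i - 1))"
    by (simp add: h comp_assoc)
  also have "\<dots> = transl \<psi> (of_int i * q) \<circ> h"
    using step2(2) by (simp add: comp_assoc transl_comp \<phi>) (simp add: o_def)
  finally have "transl \<psi> (- q) \<circ> (transl \<psi> q \<circ> (h \<circ> transl \<phi> (of_int (i - 1))))
    = transl \<psi> (- q) \<circ> (transl \<psi> (of_int i * q) \<circ> h)" by simp
  then show ?case
    by (simp add: comp_assoc[symmetric] transl_comp \<psi> transl_0 algebra_simps)
qed

text \<open>Distinct translations disagree at every point, so h can be cancelled on the right even
  when it is far from surjective.\<close>

lemma transl_comp_right_inj:
  "\<phi> \<in> anti_autQ \<Longrightarrow> transl \<phi> p \<circ> h = transl \<phi> q \<circ> h \<longleftrightarrow> p = q"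
  by (metis comp_apply transl_apply_inj)

text \<open>Whether a positive q moves points up or down depends on the orientation of \<phi>; what
  is invariant is that opposite signs move all points in opposite directions. This will exclude
  negative factors in the multiplication.\<close>

lemma transl_opposite_signs:
  assumes "\<phi> \<in> anti_autQ" "p > 0" "q < 0"
  shows "(transl \<phi> p x > x \<and> transl \<phi> q y < y) \<or> (transl \<phi> p x < x \<and> transl \<phi> q y > y)"
proof -
  have *: "transl \<phi> q x < transl \<phi> r x" if "\<phi> \<in> autQ" "q < r" for \<phi> q r x
    using that by (auto simp: transl_def conjQ_def autQ_def strict_mono_def)
  have id: "transl \<phi> 0 x = x" for x using transl_0[OF assms(1)] by simp
  show ?thesis using assms(1)
  proof (cases rule: anti_autQ_cases)
    case 1
    then show ?thesis using *[OF 1] assms id by metis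
  next
    case 2
    have "transl \<phi> r x < transl \<phi> q x" if "q < r" for q r x
      using *[OF 2, of "- r" "- q"] that by (simp add: transl_uminus assms(1))
    then show ?thesis using assms id by metis
  qed
qed

section \<open>Shifts, their charts and their integer powers\<close>

definition shifts :: "(rat \<Rightarrow> rat) set" where
  "shifts = {t. \<exists>\<phi>\<in>anti_autQ. t = transl \<phi> 1}"

definition chart :: "(rat \<Rightarrow> rat) \<Rightarrow> rat \<Rightarrow> rat" where
  "chart t = (SOME \<phi>. \<phi> \<in> anti_autQ \<and> t = transl \<phi> 1)"

text \<open>This is t^n for whichever chart is chosen. Passing through a chart treats negative
  exponents uniformly and gives the group law at once.\<close>

definition pw :: "(rat \<Rightarrow> rat) \<Rightarrow> int \<Rightarrow> rat \<Rightarrow> rat" where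
  "pw t n = transl (chart t) (of_int n)"

lemma chart:
  assumes "t \<in> shifts"
  shows "chart t \<in> anti_autQ" "transl (chart t) 1 = t"
proof -
  have "\<exists>\<phi>. \<phi> \<in> anti_autQ \<and> t = transl \<phi> 1" using assms by (auto simp: shifts_def)
  from someI_ex[OF this] show "chart t \<in> anti_autQ" "transl (chart t) 1 = t"
    by (simp_all add: chart_def)
qed

lemma pw_1: "t \<in> shifts \<Longrightarrow> pw t 1 = t"
  by (simp add: pw_def chart)

lemma pw_inj: "t \<in> shifts \<Longrightarrow> pw t m = pw t n \<longleftrightarrow> m = n"
  by (simp add: pw_def chart transl_inj)

lemma pw_add: "t \<in> shifts \<Longrightarrow> pw t m \<circ> pw t n = pw t (m + n)"
  by (simp add: pw_def chart transl_comp)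

lemma pw_autQ: "t \<in> shifts \<Longrightarrow> pw t n \<in> autQ"
  by (simp add: pw_def chart transl_autQ)

text \<open>Iterating s from the fundamental domain [x, s x) semiconjugates the unit shift into s;
  since the endpoints are rational, the domain is identified with [0,1) by an affine map.\<close>

definition ipow :: "(rat \<Rightarrow> rat) \<Rightarrow> int \<Rightarrow> rat \<Rightarrow> rat" where
  "ipow s n = (if n \<ge> 0 then s ^^ nat n else inv s ^^ nat (- n))"

lemma ipow_0: "ipow s 0 x = x"
  by (simp add: ipow_def)

lemma ipow_Suc:
  assumes "bij s" shows "ipow s (n + 1) x = s (ipow s n x)"
proof (cases "n \<ge> 0")
  case True
  then show ?thesis by (simp add: ipow_def nat_add_distrib)
next
  case False
  then obtain k where n: "n = - int (Suc k)"
    by (metis int_cases of_nat_0_le_iff)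
  have 1: "nat (- (n + 1)) = k" "nat (- n) = Suc k" using n by auto
  have "ipow s n x = inv s ((inv s ^^ k) x)" using False 1 by (simp add: ipow_def)
  then have "s (ipow s n x) = (inv s ^^ k) x"
    using assms by (simp add: bij_is_surj surj_f_inv_f)
  moreover have "ipow s (n + 1) x = (inv s ^^ k) x"
    using 1 n by (cases "n = -1") (auto simp: ipow_def)
  ultimately show ?thesis by simp
qed

lemma ipow_autQ:
  assumes "s \<in> autQ" shows "ipow s n \<in> autQ"
proof -
  have *: "g ^^ k \<in> autQ" if "g \<in> autQ" for g k
    proof (induction k)
    case 0
    then show ?case using shift_autQ[of 0] by (simp add: id_def)
  next
    case (Suc k)
    then show ?case using autQ_comp[OF that Suc] by (simp add: o_def)
  qed
  show ?thesis using *[OF assms] *[OF autQ_inv[OF assms]] by (simp add: ipow_def)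
qed

lemma ipow_Suc_right:
  assumes s: "s \<in> autQ" shows "ipow s (n + 1) x = ipow s n (s x)"
proof (induction n rule: int_induct[where k = 0])
  case base
  then show ?case using ipow_Suc[of s 0 x] s by (simp add: ipow_0 autQ_def)
next
  case (step1 i)
  have b: "bij s" using s by (simp add: autQ_def)
  show ?case using step1(2) ipow_Suc[OF b] by metis
next
  case (step2 i)
  have b: "bij s" using s by (simp add: autQ_def)
  have "s (ipow s i x) = s (ipow s (i - 1) (s x))"
    using step2(2) ipow_Suc[OF b, of i x] ipow_Suc[OF b, of "i - 1" "s x"] by simp
  then show ?case using b by (simp add: bij_is_inj inj_eq)
qed

lemma ipow_mono:
  assumes s: "s \<in> autQ" and x: "s x > x" and "m \<le> n"
  shows "ipow s m x \<le> ipow s n x"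
proof -
  have step: "ipow s m x \<le> ipow s (m + 1) x" for m
    using x ipow_autQ[OF s, of m]
    by (simp add: ipow_Suc_right[OF s] autQ_def strict_mono_less_eq)
  show ?thesis using \<open>m \<le> n\<close>
    by (induction n rule: int_ge_induct) (auto intro: order_trans[OF _ step])
qed

definition unroll :: "(rat \<Rightarrow> rat) \<Rightarrow> rat \<Rightarrow> rat \<Rightarrow> rat" where
  "unroll s x q = ipow s \<lfloor>q\<rfloor> (x + frac q * (s x - x))"

lemma unroll_shift:
  assumes "s \<in> autQ" shows "unroll s x (q + 1) = s (unroll s x q)"
  using assms ipow_Suc[of s "\<lfloor>q\<rfloor>"] by (simp add: unroll_def autQ_def frac_def)

text \<open>Within one unit interval the map is an increasing affine map followed by an iterate of
  s. Across intervals the images are separated by the orbit point with index \<lfloor>p\<rfloor> +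
  1.\<close>

lemma unroll_strict_mono:
  assumes s: "s \<in> autQ" and x: "s x > x"
  shows "strict_mono (unroll s x)"
proof (rule strict_monoI)
  fix p q :: rat assume pq: "p < q"
  note sm = ipow_autQ[OF s, unfolded autQ_def, simplified, THEN conjunct2]
  consider "\<lfloor>p\<rfloor> = \<lfloor>q\<rfloor>" | "\<lfloor>p\<rfloor> + 1 \<le> \<lfloor>q\<rfloor>"
    using floor_mono[of p q] pq by linarith
  then show "unroll s x p < unroll s x q"
  proof cases
    case 1
    then show ?thesis using pq x sm by (auto simp: unroll_def frac_def strict_mono_less)
  next
    case 2
    have "x + frac p * (s x - x) < s x"
      using mult_strict_right_mono[OF frac_lt_1[of p], of "s x - x"] x by (simp add: algebra_simps)
    moreover have "ipow s \<lfloor>p\<rfloor> (s x) = ipow s (\<lfloor>p\<rfloor> + 1) x"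
      by (simp add: ipow_Suc_right[OF s])
    ultimately have "unroll s x p < ipow s (\<lfloor>p\<rfloor> + 1) x"
      using sm unfolding unroll_def by (metis strict_mono_less)
    also have "\<dots> \<le> ipow s \<lfloor>q\<rfloor> x" using ipow_mono[OF s x 2] .
    also have "\<dots> \<le> unroll s x q"
      using sm x by (auto simp: unroll_def strict_mono_less_eq)
    finally show ?thesis .
  qed
qed


lemma int_sign_change:
  fixes m n :: int
  assumes "P m" "\<not> P n" "m \<le> n"
  shows "\<exists>k. P k \<and> \<not> P (k + 1)"
proof (rule ccontr)
  assume "\<not> ?thesis"
  then have step: "P k \<Longrightarrow> P (k + 1)" for k by blast
  have "P n" using assms(3,1) by (rule int_ge_induct) (rule step)
  then show False using assms by blast
qed

text \<open>Along the orbit of x the monotone map h grows by 1 per step, so no y lies above or below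
  the whole orbit. Hence y falls between two consecutive orbit points, an interval which the
  unrolling covers.\<close>

lemma unroll_surj:
  assumes s: "s \<in> autQ" and x: "s x > x" and h: "mono h" "\<And>y. h (s y) = h y + (1::rat)"
  shows "surj (unroll s x)"
unfolding surj_def
proof
  fix y
  have b: "bij s" using s by (simp add: autQ_def)
  have hp: "h (ipow s n x) = h x + of_int n" for n
  proof (induction n rule: int_induct[where k = 0])
    case base
    then show ?case by (simp add: ipow_0)
  next
    case (step1 i)
    then show ?case by (simp add: ipow_Suc[OF b] h)
  next
    case (step2 i)
    then show ?case using ipow_Suc[OF b, of "i - 1" x] h(2)[of "ipow s (i - 1) x"] by simp
  qed
  \<comment> \<open>As h is only weakly monotone, equal values of h do not determine the order of
    two points; a margin of one step on either side of k makes both comparisons strict.\<close>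
  define k where "k = \<lfloor>h y - h x\<rfloor>"
  have "ipow s (k - 1) x \<le> y"
  proof (rule ccontr)
    assume "\<not> ?thesis"
    then have "h y \<le> h (ipow s (k - 1) x)" using h(1) by (simp add: monoD)
    then show False using of_int_floor_le[of "h y - h x"] by (simp add: hp k_def)
  qed
  moreover have "\<not> ipow s (k + 1) x \<le> y"
  proof
    assume "ipow s (k + 1) x \<le> y"
    then have "h (ipow s (k + 1) x) \<le> h y" using h(1) by (simp add: monoD)
    then show False using floor_correct[of "h y - h x"] by (simp add: hp k_def)
  qed
  ultimately obtain n where n: "ipow s n x \<le> y" "y < ipow s (n + 1) x"
    using int_sign_change[of "\<lambda>n. ipow s n x \<le> y" "k - 1" "k + 1"] by auto
  have "bij (ipow s n)" and sm: "strict_mono (ipow s n)"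
    using ipow_autQ[OF s, of n] by (auto simp: autQ_def)
  then obtain z where z: "y = ipow s n z" by (metis bij_is_surj surjD)
  then have zx: "x \<le> z" "z < s x"
    using n sm by (auto simp: ipow_Suc_right[OF s] strict_mono_less strict_mono_less_eq)
  define q where "q = (z - x) / (s x - x)"
  have q: "0 \<le> q" "q < 1" "q * (s x - x) = z - x" using zx x by (auto simp: q_def)
  then have "\<lfloor>of_int n + q\<rfloor> = n" by (simp add: floor_eq_iff)
  then have "unroll s x (of_int n + q) = y"
    using q z by (simp add: unroll_def frac_def)
  then show "\<exists>q. y = unroll s x q" by metis
qed

subsection \<open>Semantic characterizations in the monoid\<close>

text \<open>One argument serves both monoids: maps exhibited as witnesses are strictly monotone,
  while conclusions drawn from a given element of A use only weak monotonicity.\<close>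

locale between_embQ_endQ =
  fixes A :: "(rat \<Rightarrow> rat) set"
  assumes embQ_subset: "embQ \<subseteq> A" and subset_endQ: "A \<subseteq> endQ"
begin

lemma autQ_in: "g \<in> autQ \<Longrightarrow> g \<in> A"
  using autQ_embQ embQ_subset by blast

lemma id_in: "id \<in> A"
  using shift_autQ[of 0] autQ_in by (simp add: id_def)

lemma mono_in: "g \<in> A \<Longrightarrow> mono g"
  using subset_endQ endQ_iff by blast

lemma is_id_iff: "(\<forall>x\<in>A. s \<circ> x = x) \<longleftrightarrow> s = id"
  using id_in by auto

text \<open>The language has no constant for the identity, so inverses are expressed by acting
  trivially on every x from the left. A monotone bijection is strictly monotone.\<close>

lemma unit_iff:
  assumes "s \<in> A"
  shows "(\<exists>s'\<in>A. \<forall>x\<in>A. s \<circ> (s' \<circ> x) = x \<and> s' \<circ> (s \<circ> x) = x) \<longleftrightarrow> s \<in> autQ" (is "?L \<longleftrightarrow> _")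
proof
  assume ?L
  then obtain s' where s': "s \<circ> s' = id" "s' \<circ> s = id"
    using id_in by (metis comp_id)
  then have b: "bij s" using o_bij by blast
  have "strict_mono s"
    using mono_in[OF assms] b by (meson bij_is_inj strict_mono_iff_mono)
  with b show "s \<in> autQ" by (simp add: autQ_def)
next
  assume s: "s \<in> autQ"
  then have "bij s" by (simp add: autQ_def)
  then show ?L using autQ_in[OF autQ_inv[OF s]]
    by (intro bexI[of _ "inv s"])
      (auto simp: fun_eq_iff bij_is_inj bij_is_surj surj_f_inv_f)
qed

text \<open>Some point is moved by s, and unrolling from there, along s or its inverse, gives an
  embedding that turns x + 1 into that map. The second alternative is h t = s^(-1) h, written
  without an inverse because only composition is available.\<close>

lemma semiconj_shift_into:
  assumes s: "s \<in> autQ" "s \<noteq> id" and t: "t \<in> shifts"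
  shows "\<exists>h\<in>A. h \<circ> t = s \<circ> h \<or> s \<circ> (h \<circ> t) = h"
proof -
  obtain \<phi> where \<phi>: "\<phi> \<in> anti_autQ" "t = transl \<phi> 1" using t by (auto simp: shifts_def)
  have b: "bij s" using s by (simp add: autQ_def)
  obtain g :: "rat \<Rightarrow> rat" where g: "strict_mono g" "(\<forall>q. g (q + 1) = s (g q)) \<or> (\<forall>q. s (g (q + 1)) = g q)"
  proof -
    obtain x where x: "s x \<noteq> x" using s by (metis eq_id_iff)
    show ?thesis
    proof (cases "s x > x")
      case True
      then show ?thesis
        using that[of "unroll s x"] unroll_strict_mono unroll_shift s by blast
    next
      case False
      \<comment> \<open>Here s moves x down; starting from s x, the inverse moves upwards, as
        unrolling requires.\<close>
      then have "inv s (s x) > s x" using x b by (simp add: bij_is_inj)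
      then have "strict_mono (unroll (inv s) (s x))"
        using unroll_strict_mono autQ_inv s by blast
      moreover have "s (unroll (inv s) (s x) (q + 1)) = unroll (inv s) (s x) q" for q
        using b by (simp add: unroll_shift[OF autQ_inv[OF s(1)]] bij_is_surj surj_f_inv_f)
      ultimately show ?thesis using that by blast
    qed
  qed
  have bp: "bij \<phi>" using \<phi> anti_autQ_bij by blast
  from \<phi>(1) show ?thesis
  proof (cases rule: anti_autQ_cases)
    case 1
    let ?h = "g \<circ> inv \<phi>"
    have "?h \<in> A" using g(1) autQ_inv[OF 1] embQ_subset
      by (auto simp: autQ_def embQ_iff[symmetric] embQ_def)
    moreover have "?h (t x) = g (inv \<phi> x + 1)" for x
      using bp by (simp add: \<phi>(2) transl_def conjQ_def bij_is_inj)
    ultimately show ?thesis using g(2)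
      by (intro bexI[of _ ?h]) (auto simp: fun_eq_iff)
  next
    case 2
    \<comment> \<open>For a reversing chart the negated coordinate is increasing, and in it t
      becomes x - 1. This interchanges the two alternatives for s.\<close>
    let ?h = "g \<circ> inv (\<phi> \<circ> uminus)"
    have h: "?h x = g (- inv \<phi> x)" for x
      using bp bij_uminus_rat by (simp add: o_inv_distrib inv_uminus_rat)
    have "?h \<in> A" using g(1) autQ_inv[OF 2] embQ_subset
      by (auto simp: autQ_def embQ_iff[symmetric] embQ_def)
    moreover have "?h (t x) = g (- inv \<phi> x - 1)" for x
      unfolding h using bp by (simp add: \<phi>(2) transl_def conjQ_def bij_is_inj)
    moreover from g(2) have "(\<forall>x. g (- inv \<phi> x - 1) = s (g (- inv \<phi> x))) \<or>
        (\<forall>x. s (g (- inv \<phi> x - 1)) = g (- inv \<phi> x))"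
      by (metis diff_add_cancel)
    ultimately show ?thesis using h
      by (intro bexI[of _ ?h]) (auto simp: fun_eq_iff)
  qed
qed

text \<open>The relation with h forces t to move points up and makes its orbits unbounded in both
  directions, so unrolling t from a single point, here 0, is already a chart.\<close>

lemma shift_if_semiconj:
  assumes t: "t \<in> autQ" and h: "h \<in> A" "\<And>x. h (t x) = h x + 1"
  shows "\<exists>\<phi>\<in>anti_autQ. t = transl \<phi> 1"
proof -
  have pos: "t 0 > 0"
  proof (rule ccontr)
    assume "\<not> ?thesis"
    then have "h (t 0) \<le> h 0" using mono_in[OF h(1)] by (simp add: monoD)
    then show False by (simp add: h)
  qed
  let ?\<phi> = "unroll t 0"
  have sm: "strict_mono ?\<phi>" by (rule unroll_strict_mono[OF t pos])
  moreover have "surj ?\<phi>" using unroll_surj[OF t pos mono_in[OF h(1)] h(2)] .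
  ultimately have b: "bij ?\<phi>" by (simp add: bij_def strict_mono_imp_inj_on)
  have "t x = transl ?\<phi> 1 x" for x
    using b by (simp add: transl_def conjQ_def unroll_shift[OF t] bij_is_surj surj_f_inv_f)
  then have "t = transl ?\<phi> 1" by (simp add: fun_eq_iff)
  moreover have "?\<phi> \<in> anti_autQ" using b sm by (simp add: anti_autQ_def)
  ultimately show ?thesis by blast
qed

lemma shifts_iff:
  assumes "t \<in> A"
  shows "t \<in> autQ \<and> (\<forall>s\<in>A. s \<in> autQ \<longrightarrow> s \<noteq> id \<longrightarrow>
           (\<exists>h\<in>A. h \<circ> t = s \<circ> h \<or> s \<circ> (h \<circ> t) = h)) \<longleftrightarrow> t \<in> shifts" (is "?L \<longleftrightarrow> _")
proof
  assume L: ?L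
  \<comment> \<open>The translation by 1 is one of the quantified units, so the formula can test
    against it without naming it.\<close>
  let ?s = "\<lambda>x::rat. x + 1"
  have "?s \<noteq> id" by (auto simp: fun_eq_iff)
  then obtain h where h: "h \<in> A" "h \<circ> t = ?s \<circ> h \<or> ?s \<circ> (h \<circ> t) = h"
    using L shift_autQ[of 1] autQ_in by blast
  from h(2) show "t \<in> shifts"
  proof
    assume "h \<circ> t = ?s \<circ> h"
    then show ?thesis using shift_if_semiconj[OF _ h(1)] L unfolding shifts_def fun_eq_iff by auto
  next
    assume *: "?s \<circ> (h \<circ> t) = h"
    have b: "bij t" using L by (simp add: autQ_def)
    have "h (inv t x) = h x + 1" for x
      using fun_cong[OF *, of "inv t x"] b by (simp add: bij_is_surj surj_f_inv_f)
    then obtain \<phi> where \<phi>: "\<phi> \<in> anti_autQ" "inv t = transl \<phi> 1"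
      using shift_if_semiconj[OF autQ_inv h(1)] L by blast
    \<comment> \<open>Since the inverse of t is a shift, t itself is one, with the reversed
      chart.\<close>
    have "t = t \<circ> (transl \<phi> 1 \<circ> transl \<phi> (- 1))" by (simp add: transl_comp \<phi> transl_0)
    also have "\<dots> = transl (\<phi> \<circ> uminus) 1"
      using b unfolding comp_assoc[symmetric] \<phi>(2)[symmetric] transl_uminus[OF \<phi>(1)]
      by (auto simp: fun_eq_iff bij_is_surj surj_f_inv_f)
    finally show ?thesis using anti_autQ_uminus[OF \<phi>(1)] by (auto simp: shifts_def)
  qed
next
  assume "t \<in> shifts"
  then show ?L using semiconj_shift_into transl_autQ by (auto simp: shifts_def)
qed

text \<open>In the chart, t is x + 1, and its centralizer contains all translations and the
  embedding \<open>c\<close> below. Commuting with \<open>c\<close> makes w 0 a fixed point of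
  \<open>c\<close>, hence an integer; commuting with all translations makes w the translation by w
  0.\<close>

lemma bicommutant_iff:
  assumes t: "t \<in> shifts" and z: "z \<in> A"
  shows "(\<forall>a\<in>A. a \<circ> t = t \<circ> a \<longrightarrow> a \<circ> z = z \<circ> a) \<longleftrightarrow> (\<exists>n. z = pw t n)" (is "?L \<longleftrightarrow> _")
proof
  assume L: ?L
  define \<phi> where "\<phi> = chart t"
  have \<phi>: "\<phi> \<in> anti_autQ" and tr: "transl \<phi> 1 = t" using chart[OF t] by (auto simp: \<phi>_def)
  then have b: "bij \<phi>" using anti_autQ_bij by blast
  define w where "w = inv \<phi> \<circ> z \<circ> \<phi>"
  have zw: "z = conjQ \<phi> w"
    using b by (auto simp: conjQ_def w_def fun_eq_iff bij_is_surj surj_f_inv_f)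
  have comm: "a \<circ> w = w \<circ> a" if a: "strict_mono a" "\<And>x. a (x + 1) = a x + 1" for a
  proof -
    have "conjQ \<phi> a \<in> A" using conjQ_strict_mono[OF \<phi> a(1)] embQ_subset embQ_iff by blast
    moreover have "conjQ \<phi> a \<circ> t = t \<circ> conjQ \<phi> a"
      unfolding tr[symmetric] transl_def conjQ_comp[OF b] using a(2) by (simp add: o_def)
    ultimately have "conjQ \<phi> a \<circ> z = z \<circ> conjQ \<phi> a" using L by blast
    then show ?thesis by (simp add: zw conjQ_comp conjQ_inj b)
  qed
  text \<open>An embedding commuting with the unit shift whose fixed points are the integers.\<close>
  define c :: "rat \<Rightarrow> rat" where "c x = of_int \<lfloor>x\<rfloor> + frac x * frac x" for x
  have "strict_mono c"
  proof (rule strict_monoI)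
    fix p q :: rat assume pq: "p < q"
    consider "\<lfloor>p\<rfloor> = \<lfloor>q\<rfloor>" | "\<lfloor>p\<rfloor> + 1 \<le> \<lfloor>q\<rfloor>"
      using floor_mono[of p q] pq by linarith
    then show "c p < c q"
    proof cases
      case 1
      then have "frac p < frac q" using pq by (simp add: frac_def)
      then show ?thesis using 1 by (auto simp: c_def intro!: mult_strict_mono' frac_ge_0)
    next
      case 2
      have "frac p * frac p < 1"
        using mult_strict_mono'[of "frac p" 1 "frac p" 1] frac_lt_1[of p] frac_ge_0[of p] by simp
      moreover have "(of_int \<lfloor>p\<rfloor> :: rat) + 1 \<le> of_int \<lfloor>q\<rfloor>"
        using 2 by (metis of_int_1 of_int_add of_int_le_iff)
      moreover have "frac q * frac q \<ge> 0" by simp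
      ultimately show ?thesis unfolding c_def by linarith
    qed
  qed
  moreover have "c (x + 1) = c x + 1" for x by (simp add: c_def frac_def)
  ultimately have "c (w 0) = w (c 0)" using comm[of c] by (metis comp_apply)
  then have "frac (w 0) * frac (w 0) = frac (w 0)"
    unfolding c_def by (simp add: frac_def algebra_simps)
  then have "frac (w 0) = 0" using frac_lt_1[of "w 0"] by auto
  then obtain n where n: "w 0 = of_int n" by (metis Ints_cases frac_eq_0_iff)
  have "w x = x + of_int n" for x
    using comm[of "\<lambda>y. y + x"] n
    by (auto simp: strict_mono_def fun_eq_iff dest!: spec[of _ 0] simp: add.commute)
  then have "z = pw t n" by (simp add: zw pw_def \<phi>_def transl_def fun_eq_iff conjQ_def)
  then show "\<exists>n. z = pw t n" ..
next
  assume "\<exists>n. z = pw t n"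
  then show ?L
    using semiconj_transl[OF chart(1)[OF t] chart(1)[OF t], of _ 1] chart(2)[OF t]
    by (auto simp: pw_def)
qed

text \<open>On powers of t with exponents a, b, c this is a > 0 and c = a * b. The last conjunct
  rules out a = 0, which a constant h in \<open>endQ\<close> would otherwise realize, so both
  monoids define the same relation.\<close>

definition mul :: "(rat \<Rightarrow> rat) \<Rightarrow> (rat \<Rightarrow> rat) \<Rightarrow> (rat \<Rightarrow> rat) \<Rightarrow> (rat \<Rightarrow> rat) \<Rightarrow> bool" where
  "mul t x y z \<longleftrightarrow> (\<exists>h\<in>A. h \<circ> t = x \<circ> h \<and> h \<circ> y = z \<circ> h \<and> h \<circ> t \<noteq> h)"

lemma mul_pw:
  assumes t: "t \<in> shifts"
  shows "mul t (pw t a) (pw t b) (pw t c) \<longleftrightarrow> a > 0 \<and> c = a * b"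
proof -
  define \<phi> where "\<phi> = chart t"
  have \<phi>: "\<phi> \<in> anti_autQ" and tr: "transl \<phi> 1 = t" using chart[OF t] by (auto simp: \<phi>_def)
  have pw: "pw t n = transl \<phi> (of_int n)" for n by (simp add: pw_def \<phi>_def)
  have b: "bij \<phi>" using \<phi> anti_autQ_bij by blast
  show ?thesis
  proof
    assume "mul t (pw t a) (pw t b) (pw t c)"
    then obtain h where h: "h \<in> A" "h \<circ> t = pw t a \<circ> h" "h \<circ> pw t b = pw t c \<circ> h" "h \<circ> t \<noteq> h"
      by (auto simp: mul_def)
    have "transl \<phi> (of_int b * of_int a) \<circ> h = transl \<phi> (of_int c) \<circ> h"
      using semiconj_transl[OF \<phi> \<phi>, of h "of_int a" b] h by (simp add: pw tr)
    then have "(of_int (b * a) :: rat) = of_int c" by (simp add: transl_comp_right_inj[OF \<phi>])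
    then have "c = a * b" by (simp only: of_int_eq_iff mult.commute)
    moreover have "a \<noteq> 0" using h(2,4) by (auto simp: pw transl_0[OF \<phi>])
    \<comment> \<open>A monotone h cannot carry t, moving points one way, to a power moving them the
      other way.\<close>
    moreover have "\<not> a < 0"
    proof
      assume "a < 0"
      then have "(t 0 > 0 \<and> pw t a (h 0) < h 0) \<or> (t 0 < 0 \<and> pw t a (h 0) > h 0)"
        using transl_opposite_signs[OF \<phi>, of 1 "of_int a" 0 "h 0"] by (simp add: pw tr)
      moreover have "h (t 0) = pw t a (h 0)" using fun_cong[OF h(2), of 0] by simp
      ultimately show False using mono_in[OF h(1)] by (metis less_imp_le monoD not_le)
    qed
    ultimately show "a > 0 \<and> c = a * b" by simp
  next
    assume a: "a > 0 \<and> c = a * b"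
    \<comment> \<open>Scaling by a in the chart turns the translation by n into the translation by a
      * n.\<close>
    let ?h = "conjQ \<phi> (\<lambda>x. of_int a * x)"
    have h: "?h \<in> autQ" using a by (intro conjQ_autQ \<phi> scale_autQ) simp
    have "?h \<circ> pw t n = pw t (a * n) \<circ> ?h" for n
      unfolding pw transl_def conjQ_comp[OF b] by (simp add: o_def algebra_simps)
    from this[of b] this[of 1] have "?h \<circ> pw t b = pw t c \<circ> ?h" "?h \<circ> t = pw t a \<circ> ?h"
      using a pw_1[OF t] by simp_all
    moreover have "?h \<circ> t \<noteq> ?h"
    proof
      assume "?h \<circ> t = ?h"
      then have "(\<lambda>x. of_int a * (x + 1)) = (\<lambda>x. of_int a * x :: rat)"
        unfolding tr[symmetric] transl_def conjQ_comp[OF b] conjQ_inj[OF b] by (simp add: o_def)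
      from fun_cong[OF this, of 0] show False using a by simp
    qed
    ultimately show "mul t (pw t a) (pw t b) (pw t c)"
      unfolding mul_def using autQ_in[OF h] by blast
  qed
qed

text \<open>The second alternative covers shifts moving points in opposite directions: u carries t
  to the inverse of t' and z to the inverse of z'. Both are inverted together, so the exponents are
  still compared with equal sign.\<close>

definition same_exponent ::
    "(rat \<Rightarrow> rat) \<Rightarrow> (rat \<Rightarrow> rat) \<Rightarrow> (rat \<Rightarrow> rat) \<Rightarrow> (rat \<Rightarrow> rat) \<Rightarrow> bool" where
  "same_exponent t z t' z' \<longleftrightarrow>
    (\<exists>u\<in>A. (u \<circ> t = t' \<circ> u \<and> u \<circ> z = z' \<circ> u) \<or> (t' \<circ> (u \<circ> t) = u \<and> z' \<circ> (u \<circ> z) = u))"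

lemma same_exponent_pw:
  assumes t: "t \<in> shifts" and t': "t' \<in> shifts"
  shows "same_exponent t (pw t m) t' (pw t' n) \<longleftrightarrow> m = n"
proof -
  define \<phi> where "\<phi> = chart t"
  have \<phi>: "\<phi> \<in> anti_autQ" and tr: "transl \<phi> 1 = t" using chart[OF t] by (auto simp: \<phi>_def)
  have pw: "pw t n = transl \<phi> (of_int n)" for n by (simp add: pw_def \<phi>_def)
  define \<psi> where "\<psi> = chart t'"
  have \<psi>: "\<psi> \<in> anti_autQ" and tr': "transl \<psi> 1 = t'" using chart[OF t'] by (auto simp: \<psi>_def)
  have pw': "pw t' n = transl \<psi> (of_int n)" for n by (simp add: pw_def \<psi>_def)
  have b: "bij \<phi>" "bij \<psi>" using \<phi> \<psi> anti_autQ_bij by auto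
  have flip: "transl \<psi> q \<circ> f = g \<longleftrightarrow> f = transl \<psi> (- q) \<circ> g" for f g :: "rat \<Rightarrow> rat" and q
  proof -
    have "transl \<psi> (- q) \<circ> (transl \<psi> q \<circ> f) = f" "transl \<psi> q \<circ> (transl \<psi> (- q) \<circ> g) = g"
      by (simp_all add: comp_assoc[symmetric] transl_comp[OF \<psi>] transl_0[OF \<psi>])
    then show ?thesis by metis
  qed
  show ?thesis
  proof
    assume "same_exponent t (pw t m) t' (pw t' n)"
    then obtain u where
      "(u \<circ> t = t' \<circ> u \<and> u \<circ> pw t m = pw t' n \<circ> u) \<or>
       (t' \<circ> (u \<circ> t) = u \<and> pw t' n \<circ> (u \<circ> pw t m) = u)"
      unfolding same_exponent_def by blast
    then show "m = n"
    proof
      assume *: "u \<circ> t = t' \<circ> u \<and> u \<circ> pw t m = pw t' n \<circ> u"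
      then have "u \<circ> pw t m = transl \<psi> (of_int m) \<circ> u"
        using semiconj_transl[OF \<phi> \<psi>, of u 1 m] by (simp add: tr tr' pw)
      then show ?thesis using * transl_comp_right_inj[OF \<psi>] by (metis of_int_eq_iff pw')
    next
      assume "t' \<circ> (u \<circ> t) = u \<and> pw t' n \<circ> (u \<circ> pw t m) = u"
      then have *: "u \<circ> t = transl \<psi> (- 1) \<circ> u \<and> u \<circ> pw t m = transl \<psi> (- of_int n) \<circ> u"
        using flip[of 1 "u \<circ> t" u, unfolded tr'] flip[of "of_int n" "u \<circ> pw t m" u, folded pw']
        by blast
      then have "u \<circ> pw t m = transl \<psi> (- of_int m) \<circ> u"
        using semiconj_transl[OF \<phi> \<psi>, of u "-1" m] by (simp add: tr pw)
      then show ?thesis using * transl_comp_right_inj[OF \<psi>]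
        by (metis of_int_eq_iff neg_equal_iff_equal)
    qed
  next
    assume "m = n"
    \<comment> \<open>The change of coordinates between the two charts is increasing as it stands or
      after inserting a negation, according to whether their orientations agree.\<close>
    have "strict_mono (\<psi> \<circ> inv \<phi>) \<or> strict_mono (\<psi> \<circ> uminus \<circ> inv \<phi>)"
    proof -
      have i: "strict_mono (inv \<phi>) \<or> strict_mono (uminus \<circ> inv \<phi>)"
        using \<phi>
      proof (cases rule: anti_autQ_cases)
        case 2
        then have "strict_mono (inv (\<phi> \<circ> uminus))" using autQ_inv autQ_def by blast
        then show ?thesis using b bij_uminus_rat by (simp add: o_inv_distrib inv_uminus_rat)
      qed (use autQ_inv autQ_def in blast)
      have j: "strict_mono \<psi> \<or> strict_mono (\<psi> \<circ> uminus)"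
        using \<psi> by (auto simp: anti_autQ_def o_def)
      have comp: "strict_mono (f \<circ> g)" if "strict_mono f" "strict_mono g" for f g :: "rat \<Rightarrow> rat"
        using that by (auto simp: strict_mono_def)
      from i j show ?thesis
        using comp[of \<psi> "inv \<phi>"] comp[of \<psi> "uminus \<circ> inv \<phi>"] comp[of "\<psi> \<circ> uminus" "inv \<phi>"]
          comp[of "\<psi> \<circ> uminus" "uminus \<circ> inv \<phi>"]
        by (auto simp: o_def)
    qed
    then show "same_exponent t (pw t m) t' (pw t' n)"
    proof
      let ?u = "\<psi> \<circ> inv \<phi>"
      assume "strict_mono ?u"
      then have u: "?u \<in> A" using embQ_iff embQ_subset by blast
      have *: "?u \<circ> transl \<phi> q = transl \<psi> q \<circ> ?u" for q
        using b by (auto simp: transl_def conjQ_def fun_eq_iff bij_is_inj)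
      show ?thesis unfolding same_exponent_def
        using u *[of 1] *[of "of_int n"] by (auto simp: tr tr' pw pw' \<open>m = n\<close>)
    next
      let ?u = "\<psi> \<circ> uminus \<circ> inv \<phi>"
      assume "strict_mono ?u"
      then have u: "?u \<in> A" using embQ_iff embQ_subset by blast
      have *: "?u \<circ> transl \<phi> q = transl \<psi> (- q) \<circ> ?u" for q
        using b by (auto simp: transl_def conjQ_def fun_eq_iff bij_is_inj)
      have "t' \<circ> (?u \<circ> t) = ?u \<and> pw t' n \<circ> (?u \<circ> pw t m) = ?u"
        using flip[of 1 "?u \<circ> t" ?u, unfolded tr'] flip[of "of_int n" "?u \<circ> pw t n" ?u, folded pw']
          *[of 1, unfolded tr] *[of "of_int n", folded pw] \<open>m = n\<close> by blast
      then show ?thesis unfolding same_exponent_def using u by blast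
    qed
  qed
qed

end

subsection \<open>Coding finite sets of rationals\<close>

lemma finite_rats_common_denominator:
  fixes F :: "rat set"
  assumes "finite F"
  shows "\<exists>k>0. \<forall>r\<in>F. \<exists>n. r = of_int n / of_int k"
  using assms
proof (induction F)
  case empty
  show ?case by (intro exI[of _ 1]) simp
next
  case (insert r F)
  then obtain k where k: "k > 0" "\<forall>r\<in>F. \<exists>n. r = of_int n / of_int k" by blast
  obtain a b where ab: "r = of_int a / of_int b" "b > 0"
    using quotient_of_div[of r] quotient_of_denom_pos[of r] by (metis prod.collapse)
  have "\<exists>n. q = of_int n / of_int (k * b)" if q: "q \<in> insert r F" for q
  proof (cases "q = r")
    case True
    then show ?thesis using ab k by (intro exI[of _ "a * k"]) simp
  next
    case False
    then obtain n where "q = of_int n / of_int k" using k q False by blast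
    then show ?thesis using ab k by (intro exI[of _ "n * b"]) simp
  qed
  then show ?case using ab k by (intro exI[of _ "k * b"]) auto
qed

text \<open>The window (a, b) keeps every code finite, even for u = 0, where divisibility holds
  throughout. Positivity of v and of c + v n is built in because the definable multiplication
  accepts only a positive left factor.\<close>

definition coded_set :: "int \<Rightarrow> int \<Rightarrow> int \<Rightarrow> int \<Rightarrow> int \<Rightarrow> int \<Rightarrow> rat set" where
  "coded_set k a b c v u =
    {of_int n / of_int k |n. a < n \<and> n < b \<and> 0 < v \<and> 0 < c + v * n \<and> (c + v * n) dvd u}"

lemma finite_coded_set: "finite (coded_set k a b c v u)"
proof -
  have "coded_set k a b c v u \<subseteq> (\<lambda>n. of_int n / of_int k) ` {a<..<b}"
    by (auto simp: coded_set_def)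
  then show ?thesis by (rule finite_subset) simp
qed

text \<open>A common divisor is coprime to v, as it divides 1 + v i. It divides v (i - j), hence i -
  j, hence v, and so is a unit.\<close>

lemma coprime_beta:
  fixes v i j :: int
  assumes "(i - j) dvd v"
  shows "coprime (1 + v * i) (1 + v * j)"
proof (rule coprimeI)
  fix d assume d: "d dvd 1 + v * i" "d dvd 1 + v * j"
  have cop: "coprime d v"
  proof (rule coprimeI)
    fix e assume "e dvd d" "e dvd v"
    then have "e dvd (1 + v * i) - v * i" using d by (meson dvd_diff dvd_mult2 dvd_trans)
    then show "is_unit e" by simp
  qed
  have "d dvd (1 + v * i) - (1 + v * j)" using d by (rule dvd_diff)
  then have "d dvd v * (i - j)" by (simp add: algebra_simps)
  then have "d dvd i - j" using cop by (simp add: coprime_dvd_mult_right_iff)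
  then have "d dvd v" using assms by (rule dvd_trans)
  then show "is_unit d" using cop by (metis coprime_common_divisor dvd_refl)
qed

text \<open>Goedel's beta function over a common denominator; the shift by B + 1 makes the multipliers of v
  positive.\<close>

lemma ex_coded_set:
  fixes F :: "rat set"
  assumes "finite F"
  shows "\<exists>k a b c v u. k > 0 \<and> coded_set k a b c v u = F"
proof -
  obtain k where k: "k > 0" "\<forall>r\<in>F. \<exists>n. r = of_int n / of_int k"
    using finite_rats_common_denominator[OF assms] by blast
  define N where "N = {n::int. of_int n / of_int k \<in> F}"
  have F: "F = (\<lambda>n. of_int n / of_int k) ` N" using k by (auto simp: N_def)
  have "inj_on (\<lambda>n. of_int n / of_int k :: rat) N" using k by (auto simp: inj_on_def)
  then have fin: "finite N" using assms F finite_image_iff by metis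
  \<comment> \<open>Inserting 0 makes the maximum meaningful for empty N and gives B \<ge>
    0.\<close>
  define B where "B = Max (insert 0 (abs ` N))"
  have B: "B \<ge> 0" "\<And>n. n \<in> N \<Longrightarrow> \<bar>n\<bar> \<le> B" using fin by (auto simp: B_def)
  \<comment> \<open>Numbers in [-B, B] differ by at most 2 B, so each nonzero difference divides
    this factorial, as coprimality of the moduli requires.\<close>
  define v :: int where "v = fact (nat (2 * B + 1))"
  define c where "c = 1 + v * (B + 1)"
  define u where "u = (\<Prod>n\<in>N. c + v * n)"
  have v: "v > 0" by (simp add: v_def)
  have c: "c + v * n = 1 + v * (n + B + 1)" for n by (simp add: c_def algebra_simps)
  have pos: "c + v * n > 1" if "\<bar>n\<bar> \<le> B" for n using that v by (simp add: c)
  have "(c + v * n) dvd u \<longleftrightarrow> n \<in> N" if n: "\<bar>n\<bar> \<le> B" for n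
  proof
    assume "n \<in> N"
    then show "(c + v * n) dvd u" unfolding u_def using fin by (rule dvd_prodI[rotated])
  next
    assume dvd: "(c + v * n) dvd u"
    show "n \<in> N"
    proof (rule ccontr)
      assume "n \<notin> N"
      have "coprime (c + v * n) (c + v * m)" if m: "m \<in> N" for m
      proof -
        have "n \<noteq> m" using m \<open>n \<notin> N\<close> by blast
        then have "nat \<bar>n - m\<bar> dvd fact (nat (2 * B + 1))"
          using n B(2)[OF m] by (intro dvd_fact) auto
        then have "int (nat \<bar>n - m\<bar>) dvd int (fact (nat (2 * B + 1)))" by (simp only: of_nat_dvd_iff)
        then have "(n - m) dvd v" by (simp add: v_def)
        then show ?thesis unfolding c by (intro coprime_beta) simp
      qed
      then have "coprime (c + v * n) u" unfolding u_def by (rule prod_coprime_right)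
      then have "is_unit (c + v * n)" using dvd by (metis coprime_common_divisor dvd_refl)
      then show False using pos[OF n] by simp
    qed
  qed
  \<comment> \<open>The window of a code excludes its endpoints, so they lie one step outside
    [-B, B].\<close>
  moreover have "- B - 1 < n \<and> n < B + 1 \<longleftrightarrow> \<bar>n\<bar> \<le> B" for n by auto
  ultimately have "coded_set k (- B - 1) (B + 1) c v u = F"
    unfolding coded_set_def F using v pos B(2) by (force simp flip: conj_assoc)
  then show ?thesis using k by blast
qed

subsection \<open>Formulas\<close>

abbreviation cv :: "nat \<Rightarrow> nat \<Rightarrow> fterm" where
  "cv i j \<equiv> Comp (V i) (V j)"

definition fDisj :: "fform \<Rightarrow> fform \<Rightarrow> fform" where
  "fDisj \<phi> \<psi> = Neg (Conj (Neg \<phi>) (Neg \<psi>))"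

definition fImp :: "fform \<Rightarrow> fform \<Rightarrow> fform" where
  "fImp \<phi> \<psi> = Neg (Conj \<phi> (Neg \<psi>))"

definition fAll :: "nat \<Rightarrow> fform \<Rightarrow> fform" where
  "fAll i \<phi> = Neg (Ex i (Neg \<phi>))"

lemma sat_fDisj [simp]: "sat A f \<rho> (fDisj \<phi> \<psi>) \<longleftrightarrow> sat A f \<rho> \<phi> \<or> sat A f \<rho> \<psi>"
  by (simp add: fDisj_def)

lemma sat_fImp [simp]: "sat A f \<rho> (fImp \<phi> \<psi>) \<longleftrightarrow> (sat A f \<rho> \<phi> \<longrightarrow> sat A f \<rho> \<psi>)"
  by (simp add: fImp_def)

lemma sat_fAll [simp]: "sat A f \<rho> (fAll i \<phi>) \<longleftrightarrow> (\<forall>a\<in>A. sat A f (\<rho>(i := a)) \<phi>)"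
  by (simp add: fAll_def)

text \<open>In the formulas below, the argument k is the first index used for bound variables,
  so it has to exceed the indices of all variable arguments. In mem_form the code of the finite
  set occupies the variables t, ..., t + 6.\<close>

definition unit_form :: "nat \<Rightarrow> nat \<Rightarrow> fform" where
  "unit_form k s = Ex k (fAll (k + 1)
     (Conj (Eq (Comp (V s) (cv k (k + 1))) (V (k + 1))) (Eq (Comp (V k) (cv s (k + 1))) (V (k + 1)))))"

definition shift_form :: "nat \<Rightarrow> nat \<Rightarrow> fform" where
  "shift_form k t = Conj (unit_form k t)
     (fAll k (fImp (unit_form (k + 1) k) (fImp (Neg (fAll (k + 1) (Eq (cv k (k + 1)) (V (k + 1)))))
       (Ex (k + 1) (fDisj (Eq (cv (k + 1) t) (cv k (k + 1)))
                         (Eq (Comp (V k) (cv (k + 1) t)) (V (k + 1))))))))"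

definition pw_form :: "nat \<Rightarrow> nat \<Rightarrow> nat \<Rightarrow> fform" where
  "pw_form k t z = fAll k (fImp (Eq (cv k t) (cv t k)) (Eq (cv k z) (cv z k)))"

definition mul_form :: "nat \<Rightarrow> nat \<Rightarrow> nat \<Rightarrow> nat \<Rightarrow> nat \<Rightarrow> fform" where
  "mul_form k t x y z = Ex k (Conj (Eq (cv k t) (cv x k))
     (Conj (Eq (cv k y) (cv z k)) (Neg (Eq (cv k t) (V k)))))"

definition same_exponent_form :: "nat \<Rightarrow> nat \<Rightarrow> nat \<Rightarrow> nat \<Rightarrow> nat \<Rightarrow> fform" where
  "same_exponent_form k t z t' z' = Ex k (fDisj
     (Conj (Eq (cv k t) (cv t' k)) (Eq (cv k z) (cv z' k)))
     (Conj (Eq (Comp (V t') (cv k t)) (V k)) (Eq (Comp (V z') (cv k z)) (V k))))"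

definition Ex_pw :: "nat \<Rightarrow> nat \<Rightarrow> fform \<Rightarrow> fform" where
  "Ex_pw t i \<phi> = Ex i (Conj (pw_form (i + 1) t i) \<phi>)"

text \<open>As t has exponent 1, the relation reads a > 0 and a = a * 1.\<close>

definition pos_form :: "nat \<Rightarrow> nat \<Rightarrow> nat \<Rightarrow> fform" where
  "pos_form k t x = mul_form k t x t x"

definition less_form :: "nat \<Rightarrow> nat \<Rightarrow> nat \<Rightarrow> nat \<Rightarrow> fform" where
  "less_form k t x y = Ex_pw t k (Conj (pos_form (k + 1) t k) (Eq (cv x k) (V y)))"

text \<open>The triple t, t^a, t^b codes the fraction a / b.\<close>

definition point_form :: "nat \<Rightarrow> nat \<Rightarrow> nat \<Rightarrow> nat \<Rightarrow> fform" where
  "point_form k t x y =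
     Conj (shift_form k t) (Conj (pw_form k t x) (Conj (pw_form k t y) (pos_form k t y)))"

text \<open>Cross-multiplication: a and b are transferred to the shift t', and \<open>R\<close>
  compares b' a with b a'. The positive denominators stand on the left of the products, where
  positivity is demanded. Equality and order of rationals are both instances.\<close>

definition cmp_form :: "(nat \<Rightarrow> nat \<Rightarrow> nat \<Rightarrow> fform) \<Rightarrow>
    nat \<Rightarrow> nat \<Rightarrow> nat \<Rightarrow> nat \<Rightarrow> nat \<Rightarrow> nat \<Rightarrow> nat \<Rightarrow> fform" where
  "cmp_form R k t x y t' x' y' =
     Ex_pw t' k (Conj (same_exponent_form (k + 1) t x t' k)
     (Ex_pw t' (k + 1) (Conj (same_exponent_form (k + 2) t y t' (k + 1))
     (Ex_pw t' (k + 2) (Conj (mul_form (k + 3) t' y' k (k + 2))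
     (Ex_pw t' (k + 3) (Conj (mul_form (k + 4) t' (k + 1) x' (k + 3))
       (R (k + 4) (k + 2) (k + 3)))))))))"

definition set_form :: fform where
  "set_form = Conj (shift_form 7 0) (Conj (pw_form 7 0 1) (Conj (pw_form 7 0 2)
     (Conj (pw_form 7 0 3) (Conj (pw_form 7 0 4) (Conj (pw_form 7 0 5) (Conj (pw_form 7 0 6)
     (pos_form 7 0 1)))))))"

text \<open>For the point p / q and a set code with denominator l, the bound variables k, ..., k + 6
  hold, as powers of the shift of the set code: p, q, a candidate n in the window, the common value
  of q n and l p, then v n, c + v n, and the cofactor witnessing that c + v n divides u.\<close>

definition mem_form :: "nat \<Rightarrow> nat \<Rightarrow> nat \<Rightarrow> nat \<Rightarrow> nat \<Rightarrow> fform" where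
  "mem_form k t' x' y' t =
     Ex_pw t k (Conj (same_exponent_form (k + 1) t' x' t k)
     (Ex_pw t (k + 1) (Conj (same_exponent_form (k + 2) t' y' t (k + 1))
     (Ex_pw t (k + 2) (Conj (less_form (k + 3) t (t + 2) (k + 2))
     (Conj (less_form (k + 3) t (k + 2) (t + 3))
     (Ex_pw t (k + 3) (Conj (mul_form (k + 4) t (k + 1) (k + 2) (k + 3))
     (Conj (mul_form (k + 4) t (t + 1) k (k + 3))
     (Ex_pw t (k + 4) (Conj (mul_form (k + 5) t (t + 5) (k + 2) (k + 4))
     (Ex_pw t (k + 5) (Conj (Eq (V (k + 5)) (cv (t + 4) (k + 4)))
     (Ex_pw t (k + 6) (mul_form (k + 7) t (k + 5) (k + 6) (t + 6))))))))))))))))"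

section \<open>Correctness of the formulas\<close>

context between_embQ_endQ
begin

abbreviation satA :: "(nat \<Rightarrow> rat \<Rightarrow> rat) \<Rightarrow> fform \<Rightarrow> bool" where
  "satA \<equiv> sat A (\<circ>)"

definition env :: "(nat \<Rightarrow> rat \<Rightarrow> rat) \<Rightarrow> bool" where
  "env \<rho> \<longleftrightarrow> (\<forall>i. \<rho> i \<in> A)"

lemma env_upd [simp]: "env \<rho> \<Longrightarrow> a \<in> A \<Longrightarrow> env (\<rho>(i := a))"
  by (simp add: env_def)

lemma env_in [simp]: "env \<rho> \<Longrightarrow> \<rho> i \<in> A"
  by (simp add: env_def)

lemma pw_in [simp]: "t \<in> shifts \<Longrightarrow> pw t n \<in> A"
  using autQ_in pw_autQ by blast

text \<open>\<open>holds\<close> ranges over all valuations extending the tuple. When they all give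
  the same answer Q, it remains to see that one exists, and padding with the identity provides
  it.\<close>

lemma holds_iff:
  assumes "set xs \<subseteq> A"
    and "\<And>\<rho>. env \<rho> \<Longrightarrow> (\<And>i. i < length xs \<Longrightarrow> \<rho> i = xs ! i) \<Longrightarrow> satA \<rho> \<phi> \<longleftrightarrow> Q"
  shows "holds A (\<circ>) \<phi> xs \<longleftrightarrow> Q"
proof -
  define \<rho> where "\<rho> i = (if i < length xs then xs ! i else id)" for i
  have "env \<rho>" using assms(1) id_in by (auto simp: env_def \<rho>_def)
  then show ?thesis
    using assms(2)[of \<rho>] assms(2) by (auto simp: holds_def env_def[symmetric] \<rho>_def)
qed

lemma sat_unit_form:
  assumes "env \<rho>" "s < k"
  shows "satA \<rho> (unit_form k s) \<longleftrightarrow> \<rho> s \<in> autQ"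
  using assms unit_iff[of "\<rho> s"] by (simp add: unit_form_def)

lemma sat_shift_form:
  assumes "env \<rho>" "t < k"
  shows "satA \<rho> (shift_form k t) \<longleftrightarrow> \<rho> t \<in> shifts"
  using assms shifts_iff[of "\<rho> t"]
  by (simp add: shift_form_def sat_unit_form is_id_iff[unfolded Ball_def] Ball_def)

lemma sat_pw_form:
  assumes "env \<rho>" "\<rho> t \<in> shifts" "t < k" "z < k"
  shows "satA \<rho> (pw_form k t z) \<longleftrightarrow> (\<exists>n. \<rho> z = pw (\<rho> t) n)"
  using assms bicommutant_iff[of "\<rho> t" "\<rho> z"] by (simp add: pw_form_def)

lemma sat_mul_form:
  assumes "t < k" "x < k" "y < k" "z < k"
  shows "satA \<rho> (mul_form k t x y z) \<longleftrightarrow> mul (\<rho> t) (\<rho> x) (\<rho> y) (\<rho> z)"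
  using assms by (simp add: mul_form_def mul_def)

lemma sat_same_exponent_form:
  assumes "t < k" "z < k" "t' < k" "z' < k"
  shows "satA \<rho> (same_exponent_form k t z t' z') \<longleftrightarrow> same_exponent (\<rho> t) (\<rho> z) (\<rho> t') (\<rho> z')"
  using assms by (simp add: same_exponent_form_def same_exponent_def)

lemma sat_Ex_pw:
  assumes "env \<rho>" "\<rho> t \<in> shifts" "t < i"
  shows "satA \<rho> (Ex_pw t i \<phi>) \<longleftrightarrow> (\<exists>n. satA (\<rho>(i := pw (\<rho> t) n)) \<phi>)"
proof -
  have "satA (\<rho>(i := a)) (pw_form (i + 1) t i) \<longleftrightarrow> (\<exists>n. a = pw (\<rho> t) n)" if "a \<in> A" for a
    using assms that sat_pw_form[of "\<rho>(i := a)" t "i + 1" i] by simp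
  then show ?thesis using assms by (auto simp: Ex_pw_def)
qed

lemma sat_pos_form:
  assumes "t < k" "x < k" "\<rho> t \<in> shifts" "\<rho> x = pw (\<rho> t) a"
  shows "satA \<rho> (pos_form k t x) \<longleftrightarrow> a > 0"
  using assms mul_pw[of "\<rho> t" a 1 a] by (simp add: pos_form_def sat_mul_form pw_1)

lemma sat_less_form:
  assumes "env \<rho>" "\<rho> t \<in> shifts" "t < k" "x < k" "y < k" "\<rho> x = pw (\<rho> t) a" "\<rho> y = pw (\<rho> t) b"
  shows "satA \<rho> (less_form k t x y) \<longleftrightarrow> a < b"
proof -
  have "satA \<rho> (less_form k t x y) \<longleftrightarrow> (\<exists>n. 0 < n \<and> a + n = b)"
    using assms by (simp add: less_form_def sat_Ex_pw sat_pos_form[where a = "_ :: int"] pw_add pw_inj)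
  also have "\<dots> \<longleftrightarrow> a < b" by (auto intro: exI[of _ "b - a"])
  finally show ?thesis .
qed

lemma sat_point_form:
  assumes "env \<rho>" "t < k" "x < k" "y < k"
  shows "satA \<rho> (point_form k t x y) \<longleftrightarrow>
    \<rho> t \<in> shifts \<and> (\<exists>a b. \<rho> x = pw (\<rho> t) a \<and> \<rho> y = pw (\<rho> t) b \<and> b > 0)"
  using assms by (auto simp: point_form_def sat_shift_form sat_pw_form sat_pos_form pw_inj)

lemma sat_cmp_form:
  assumes "env \<rho>" "\<rho> t \<in> shifts" "\<rho> t' \<in> shifts"
    and "t < k" "x < k" "y < k" "t' < k" "x' < k" "y' < k"
    and "\<rho> x = pw (\<rho> t) a" "\<rho> y = pw (\<rho> t) b" "\<rho> x' = pw (\<rho> t') a'" "\<rho> y' = pw (\<rho> t') b'"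
    and "b > 0" "b' > 0"
    and R: "\<And>\<rho>' m n. env \<rho>' \<Longrightarrow> \<rho>' t' = \<rho> t' \<Longrightarrow> \<rho>' (k + 2) = pw (\<rho> t') m \<Longrightarrow> \<rho>' (k + 3) = pw (\<rho> t') n
      \<Longrightarrow> satA \<rho>' (R (k + 4) (k + 2) (k + 3)) \<longleftrightarrow> S m n"
  shows "satA \<rho> (cmp_form R k t x y t' x' y') \<longleftrightarrow> S (b' * a) (b * a')"
  using assms(1-15)
  by (simp add: cmp_form_def sat_Ex_pw sat_same_exponent_form sat_mul_form same_exponent_pw mul_pw)
    (rule R[simplified], simp_all)

lemma sat_mem_form:
  assumes "env \<rho>" "\<rho> t \<in> shifts" "\<rho> t' \<in> shifts"
    and "x' < k" "y' < k" "t' < k" "t + 6 < k"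
    and "\<rho> x' = pw (\<rho> t') p" "\<rho> y' = pw (\<rho> t') q" "q > 0"
    and "\<rho> (t + 1) = pw (\<rho> t) l" "\<rho> (t + 2) = pw (\<rho> t) a" "\<rho> (t + 3) = pw (\<rho> t) b"
    and "\<rho> (t + 4) = pw (\<rho> t) c" "\<rho> (t + 5) = pw (\<rho> t) v" "\<rho> (t + 6) = pw (\<rho> t) u" "l > 0"
  shows "satA \<rho> (mem_form k t' x' y' t) \<longleftrightarrow> of_int p / of_int q \<in> coded_set l a b c v u"
proof -
  have "satA \<rho> (mem_form k t' x' y' t) \<longleftrightarrow>
    (\<exists>n. a < n \<and> n < b \<and> q * n = l * p \<and> v > 0 \<and> c + v * n > 0 \<and> (\<exists>e. u = (c + v * n) * e))"
    using assms
    by (simp add: mem_form_def sat_Ex_pw sat_same_exponent_form sat_mul_form same_exponent_pw mul_pw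
        sat_less_form[where a = a] sat_less_form[where b = b] pw_add pw_inj)
  also have "\<dots> \<longleftrightarrow> of_int p / of_int q \<in> coded_set l a b c v u"
  proof -
    have "q * n = l * p \<longleftrightarrow> of_int p / of_int q = (of_int n / of_int l :: rat)" for n
    proof -
      have "of_int p / of_int q = (of_int n / of_int l :: rat) \<longleftrightarrow> (of_int (l * p) :: rat) = of_int (q * n)"
        using assms(10,17) by (simp add: field_simps)
      then show ?thesis by (simp only: of_int_eq_iff) auto
    qed
    then show ?thesis by (auto simp: coded_set_def dvd_def)
  qed
  finally show ?thesis .
qed

end

subsection \<open>The interpretation\<close>

text \<open>Coordinate maps are total on lists, hence the description operator; by injectivity of
  powers it is determinate when t is a shift and z a power of t, as on the domains used.\<close>

definition expo :: "(rat \<Rightarrow> rat) \<Rightarrow> (rat \<Rightarrow> rat) \<Rightarrow> int" where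
  "expo t z = (THE n. z = pw t n)"

lemma expo_pw [simp]: "t \<in> shifts \<Longrightarrow> expo t (pw t n) = n"
  by (auto simp: expo_def pw_inj)

definition point_val :: "(rat \<Rightarrow> rat) list \<Rightarrow> rat" where
  "point_val xs = of_int (expo (xs ! 0) (xs ! 1)) / of_int (expo (xs ! 0) (xs ! 2))"

definition set_val :: "(rat \<Rightarrow> rat) list \<Rightarrow> rat set" where
  "set_val zs = (let e = (\<lambda>i. expo (zs ! 0) (zs ! i)) in coded_set (e 1) (e 2) (e 3) (e 4) (e 5) (e 6))"

context between_embQ_endQ
begin

lemma shifts_in [simp]: "t \<in> shifts \<Longrightarrow> t \<in> A"
  using pw_in[of t 1] by (simp add: pw_1)

lemma point_dom:
  "{xs \<in> tuples A 3. holds A (\<circ>) (point_form 3 0 1 2) xs} =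
    {[t, pw t a, pw t b] |t a b. t \<in> shifts \<and> b > 0}" (is "?L = ?R")
proof -
  have *: "xs \<in> ?L \<longleftrightarrow> xs \<in> ?R" if xs: "xs = [t, x, y]" "set xs \<subseteq> A" for xs t x y
  proof -
    have "holds A (\<circ>) (point_form 3 0 1 2) xs \<longleftrightarrow>
        t \<in> shifts \<and> (\<exists>a b. x = pw t a \<and> y = pw t b \<and> b > 0)"
    proof (rule holds_iff[OF xs(2)])
      fix \<rho> assume "env \<rho>" and "\<And>i. i < length xs \<Longrightarrow> \<rho> i = xs ! i"
      from this(1) this(2)[of 0] this(2)[of 1] this(2)[of 2]
      show "satA \<rho> (point_form 3 0 1 2) \<longleftrightarrow>
          t \<in> shifts \<and> (\<exists>a b. x = pw t a \<and> y = pw t b \<and> b > 0)"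
        by (simp add: xs sat_point_form)
    qed
    then show ?thesis using xs by (auto simp: tuples_def)
  qed
  show ?thesis
  proof (intro set_eqI iffI)
    fix xs assume dom: "xs \<in> ?L"
    then obtain t x y where z: "xs = [t, x, y]" "set xs \<subseteq> A"
      by (auto simp: tuples_def numeral_eq_Suc length_Suc_conv)
    show "xs \<in> ?R" by (rule *[OF z, THEN iffD1, OF dom])
  next
    fix xs assume dom: "xs \<in> ?R"
    then obtain t x y where z: "xs = [t, x, y]" "set xs \<subseteq> A" by auto
    show "xs \<in> ?L" by (rule *[OF z, THEN iffD2, OF dom])
  qed
qed

lemma set_dom:
  "{zs \<in> tuples A 7. holds A (\<circ>) set_form zs} =
    {[t, pw t l, pw t a, pw t b, pw t c, pw t v, pw t u] |t l a b c v u. t \<in> shifts \<and> l > 0}"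
    (is "?L = ?R")
proof -
  have *: "zs \<in> ?L \<longleftrightarrow> zs \<in> ?R"
    if zs: "zs = [t, x1, x2, x3, x4, x5, x6]" "set zs \<subseteq> A" for zs t x1 x2 x3 x4 x5 x6
  proof -
    let ?Q = "t \<in> shifts \<and> (\<exists>n>0. x1 = pw t n) \<and> (\<exists>n. x2 = pw t n) \<and> (\<exists>n. x3 = pw t n) \<and>
      (\<exists>n. x4 = pw t n) \<and> (\<exists>n. x5 = pw t n) \<and> (\<exists>n. x6 = pw t n)"
    have "holds A (\<circ>) set_form zs \<longleftrightarrow> ?Q"
    proof (rule holds_iff[OF zs(2)])
      fix \<rho> assume "env \<rho>" and "\<And>i. i < length zs \<Longrightarrow> \<rho> i = zs ! i"
      from this(1) this(2)[of 0] this(2)[of 1] this(2)[of 2] this(2)[of 3] this(2)[of 4] this(2)[of 5]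
        this(2)[of 6]
      show "satA \<rho> set_form \<longleftrightarrow> ?Q"
        by (auto simp: zs set_form_def sat_shift_form sat_pw_form sat_pos_form pw_inj)
    qed
    then show ?thesis using zs by (auto simp: tuples_def)
  qed
  show ?thesis
  proof (intro set_eqI iffI)
    fix zs assume dom: "zs \<in> ?L"
    then obtain t x1 x2 x3 x4 x5 x6
      where z: "zs = [t, x1, x2, x3, x4, x5, x6]" "set zs \<subseteq> A"
      by (auto simp: tuples_def numeral_eq_Suc length_Suc_conv)
    show "zs \<in> ?R" by (rule *[OF z, THEN iffD1, OF dom])
  next
    fix zs assume dom: "zs \<in> ?R"
    then obtain t x1 x2 x3 x4 x5 x6
      where z: "zs = [t, x1, x2, x3, x4, x5, x6]" "set zs \<subseteq> A" by auto
    show "zs \<in> ?L" by (rule *[OF z, THEN iffD2, OF dom])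
  qed
qed

text \<open>The two triples fill the variables 0 to 5, so the transferred exponents are in 6 and 7,
  the two products in 8 and 9, and \<open>R\<close> may bind from 10 on.\<close>

lemma holds_cmp_form:
  assumes "t \<in> shifts" "t' \<in> shifts" "b > 0" "b' > 0"
    and "\<And>\<rho> m n. env \<rho> \<Longrightarrow> \<rho> 3 = t' \<Longrightarrow> \<rho> 8 = pw t' m \<Longrightarrow> \<rho> 9 = pw t' n
      \<Longrightarrow> satA \<rho> (R 10 8 9) \<longleftrightarrow> S m n"
  shows "holds A (\<circ>) (cmp_form R 6 0 1 2 3 4 5) ([t, pw t a, pw t b] @ [t', pw t' a', pw t' b'])
    \<longleftrightarrow> S (b' * a) (b * a')" (is "holds _ _ _ ?xs \<longleftrightarrow> _")
proof (rule holds_iff)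
  fix \<rho> assume env: "env \<rho>" and *: "\<And>i. i < length ?xs \<Longrightarrow> \<rho> i = ?xs ! i"
  have r: "\<rho> 0 = t" "\<rho> 1 = pw t a" "\<rho> 2 = pw t b" "\<rho> 3 = t'" "\<rho> 4 = pw t' a'" "\<rho> 5 = pw t' b'"
    using *[of 0] *[of 1] *[of 2] *[of 3] *[of 4] *[of 5] by simp_all
  show "satA \<rho> (cmp_form R 6 0 1 2 3 4 5) \<longleftrightarrow> S (b' * a) (b * a')"
    by (rule sat_cmp_form) (simp_all add: r[simplified] env assms(1-4) assms(5))
qed (simp add: assms(1-4))

lemma wmso_Q_interpretable_between: "wmso_Q_interpretable A (\<circ>)"
proof -
  let ?dP = "point_form 3 0 1 2"
  let ?eqP = "cmp_form (\<lambda>k x y. Eq (V x) (V y)) 6 0 1 2 3 4 5"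
  \<comment> \<open>Variable 3 is the shift of the second point, of which both products are
    powers.\<close>
  let ?lt = "cmp_form (\<lambda>k x y. less_form k 3 x y) 6 0 1 2 3 4 5"
  \<comment> \<open>Extensionality: the two set codes fill the variables 0 to 13, and a quantified
    point code in 14 to 16 tests membership in both.\<close>
  let ?eqS = "fAll 14 (fAll 15 (fAll 16 (fImp (point_form 17 14 15 16)
    (Conj (fImp (mem_form 17 14 15 16 0) (mem_form 17 14 15 16 7))
          (fImp (mem_form 17 14 15 16 7) (mem_form 17 14 15 16 0))))))"
  let ?mem = "mem_form 10 0 1 2 3"
  let ?DP = "{[t, pw t a, pw t b] |t a b. t \<in> shifts \<and> b > 0}"
  let ?DS = "{[t, pw t l, pw t a, pw t b, pw t c, pw t v, pw t u] |t l a b c v u.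
    t \<in> shifts \<and> l > 0}"
  have pv: "point_val [t, pw t a, pw t b] = of_int a / of_int b" if "t \<in> shifts" for t a b
    using that by (simp add: point_val_def)
  have sv: "set_val [t, pw t l, pw t a, pw t b, pw t c, pw t v, pw t u] = coded_set l a b c v u"
    if "t \<in> shifts" for t l a b c v u
    using that by (simp add: set_val_def)
  \<comment> \<open>One fixed shift suffices to code every rational and every finite set; the
    identity, written as the translation by 0, serves as its chart.\<close>
  obtain t0 where t0: "t0 \<in> shifts"
    using shift_autQ[of 0] autQ_anti_autQ by (auto simp: shifts_def)
  have 1: "point_val ` ?DP = UNIV"
  proof (intro set_eqI iffI UNIV_I)
    fix r :: rat
    obtain a b where "r = of_int a / of_int b" "b > 0"
      using quotient_of_div[of r] quotient_of_denom_pos[of r] by (metis prod.collapse)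
    then have "r = point_val [t0, pw t0 a, pw t0 b]" "[t0, pw t0 a, pw t0 b] \<in> ?DP"
      using t0 pv by auto
    then show "r \<in> point_val ` ?DP" by blast
  qed
  have 2: "set_val ` ?DS = {X. finite X}"
  proof (intro set_eqI iffI)
    fix X assume "X \<in> {X::rat set. finite X}"
    then obtain l a b c v u where "l > 0" "coded_set l a b c v u = X"
      using ex_coded_set[of X] by auto
    then have "X = set_val [t0, pw t0 l, pw t0 a, pw t0 b, pw t0 c, pw t0 v, pw t0 u]"
      "[t0, pw t0 l, pw t0 a, pw t0 b, pw t0 c, pw t0 v, pw t0 u] \<in> ?DS"
      using t0 sv by auto
    then show "X \<in> set_val ` ?DS" by blast
  qed (auto simp: sv finite_coded_set)
  have 3: "holds A (\<circ>) ?eqP (xs @ ys) \<longleftrightarrow> point_val xs = point_val ys"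
    if "xs \<in> ?DP" "ys \<in> ?DP" for xs ys
  proof -
    from that obtain t a b t' a' b' where *: "xs = [t, pw t a, pw t b]" "t \<in> shifts" "b > 0"
      "ys = [t', pw t' a', pw t' b']" "t' \<in> shifts" "b' > 0" by blast
    have "holds A (\<circ>) ?eqP (xs @ ys) \<longleftrightarrow> b' * a = b * a'"
      unfolding * by (rule holds_cmp_form) (auto simp: * pw_inj)
    also have "\<dots> \<longleftrightarrow> (of_int (b' * a) :: rat) = of_int (b * a')" by (simp only: of_int_eq_iff)
    also have "\<dots> \<longleftrightarrow> point_val xs = point_val ys"
      using * by (simp add: pv field_simps)
    finally show ?thesis .
  qed
  have 4: "holds A (\<circ>) ?lt (xs @ ys) \<longleftrightarrow> point_val xs < point_val ys"
    if "xs \<in> ?DP" "ys \<in> ?DP" for xs ys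
  proof -
    from that obtain t a b t' a' b' where *: "xs = [t, pw t a, pw t b]" "t \<in> shifts" "b > 0"
      "ys = [t', pw t' a', pw t' b']" "t' \<in> shifts" "b' > 0" by blast
    have "holds A (\<circ>) ?lt (xs @ ys) \<longleftrightarrow> b' * a < b * a'"
      unfolding * by (rule holds_cmp_form) (auto simp: * sat_less_form)
    also have "\<dots> \<longleftrightarrow> (of_int (b' * a) :: rat) < of_int (b * a')" by (simp only: of_int_less_iff)
    also have "\<dots> \<longleftrightarrow> point_val xs < point_val ys"
      using * by (simp add: pv field_simps)
    finally show ?thesis .
  qed
  have 5: "holds A (\<circ>) ?mem (xs @ zs) \<longleftrightarrow> point_val xs \<in> set_val zs"
    if "xs \<in> ?DP" "zs \<in> ?DS" for xs zs
  proof -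
    from that(1) obtain s p q where *: "xs = [s, pw s p, pw s q]" "s \<in> shifts" "q > 0" by blast
    from that(2) obtain t l a b c v u where **:
      "zs = [t, pw t l, pw t a, pw t b, pw t c, pw t v, pw t u]" "t \<in> shifts" "l > 0" by blast
    show ?thesis
    proof (rule holds_iff)
      fix \<rho> assume "env \<rho>" and r: "\<And>i. i < length (xs @ zs) \<Longrightarrow> \<rho> i = (xs @ zs) ! i"
      then have "satA \<rho> ?mem \<longleftrightarrow> of_int p / of_int q \<in> coded_set l a b c v u"
        using r[of 0] r[of 1] r[of 2] r[of 3] r[of 4] r[of 5] r[of 6] r[of 7] r[of 8] r[of 9] * **
        by (intro sat_mem_form) auto
      then show "satA \<rho> ?mem \<longleftrightarrow> point_val xs \<in> set_val zs" using * ** by (simp add: pv sv)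
    qed (use * ** in auto)
  qed
  have 6: "holds A (\<circ>) ?eqS (zs @ ws) \<longleftrightarrow> set_val zs = set_val ws"
    if "zs \<in> ?DS" "ws \<in> ?DS" for zs ws
  proof -
    from that(1) obtain t l a b c v u where *:
      "zs = [t, pw t l, pw t a, pw t b, pw t c, pw t v, pw t u]" "t \<in> shifts" "l > 0" by blast
    from that(2) obtain t' l' a' b' c' v' u' where **:
      "ws = [t', pw t' l', pw t' a', pw t' b', pw t' c', pw t' v', pw t' u']" "t' \<in> shifts" "l' > 0"
      by blast
    show ?thesis
    proof (rule holds_iff)
      fix \<rho> assume env: "env \<rho>" and r: "\<And>i. i < length (zs @ ws) \<Longrightarrow> \<rho> i = (zs @ ws) ! i"
      note r' = r[of 0] r[of 1] r[of 2] r[of 3] r[of 4] r[of 5] r[of 6] r[of 7] r[of 8] r[of 9]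
        r[of 10] r[of 11] r[of 12] r[of 13]
      let ?\<rho> = "\<lambda>s x y. \<rho>(14 := s, 15 := x, 16 := y)"
      have m: "satA (?\<rho> s (pw s p) (pw s q)) (mem_form 17 14 15 16 0) \<longleftrightarrow> of_int p / of_int q \<in> set_val zs"
        "satA (?\<rho> s (pw s p) (pw s q)) (mem_form 17 14 15 16 7) \<longleftrightarrow> of_int p / of_int q \<in> set_val ws"
        if "s \<in> shifts" "q > 0" for s p q
        using that env r' * **
        unfolding *(1) **(1) sv[OF *(2)] sv[OF **(2)]
        by (intro sat_mem_form; simp del: add_2_eq_Suc')+
      have "satA \<rho> ?eqS \<longleftrightarrow> (\<forall>s p q. s \<in> shifts \<longrightarrow> q > 0 \<longrightarrow>
          (of_int p / of_int q \<in> set_val zs \<longleftrightarrow> of_int p / of_int q \<in> set_val ws))"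
        (is "_ \<longleftrightarrow> ?Q")
      proof
        assume L: "satA \<rho> ?eqS"
        show ?Q
        proof (intro allI impI)
          fix s and p q :: int assume s: "s \<in> shifts" "q > 0"
          have "satA (?\<rho> s (pw s p) (pw s q)) (point_form 17 14 15 16)"
            using s env by (auto simp: sat_point_form)
          then show "of_int p / of_int q \<in> set_val zs \<longleftrightarrow> of_int p / of_int q \<in> set_val ws"
            using L s m[OF s, of p] unfolding sat_fAll sat_fImp sat.simps
            by (meson pw_in shifts_in)
        qed
      next
        assume Q: ?Q
        have "satA (?\<rho> s x y) (mem_form 17 14 15 16 0) \<longleftrightarrow> satA (?\<rho> s x y) (mem_form 17 14 15 16 7)"
          if pt: "s \<in> A" "x \<in> A" "y \<in> A" "satA (?\<rho> s x y) (point_form 17 14 15 16)" for s x y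
        proof -
          obtain p q where "s \<in> shifts" "x = pw s p" "y = pw s q" "q > 0"
            using pt env by (auto simp: sat_point_form)
          then show ?thesis using Q m[of s q p] by metis
        qed
        then show "satA \<rho> ?eqS" by simp
      qed
      also have "\<dots> \<longleftrightarrow> set_val zs = set_val ws"
      proof
        assume Q: ?Q
        show "set_val zs = set_val ws"
        proof (rule set_eqI)
          fix r :: rat
          obtain p q where "r = of_int p / of_int q" "q > 0"
            using quotient_of_div[of r] quotient_of_denom_pos[of r] by (metis prod.collapse)
          then show "r \<in> set_val zs \<longleftrightarrow> r \<in> set_val ws" using Q t0 by blast
        qed
      qed simp
      finally show "satA \<rho> ?eqS \<longleftrightarrow> set_val zs = set_val ws" .
    qed (use * ** in auto)
  qed
  show ?thesis
    unfolding wmso_Q_interpretable_def Let_def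
    by (rule exI[of _ 3], rule exI[of _ 7], rule exI[of _ ?dP], rule exI[of _ set_form],
        rule exI[of _ ?eqP], rule exI[of _ ?eqS], rule exI[of _ ?lt], rule exI[of _ ?mem],
        rule exI[of _ point_val], rule exI[of _ set_val], unfold point_dom set_dom)
      (intro conjI ballI 1 2 3 4 5 6)
qed

end

theorem theorem3p2:
  shows "wmso_Q_interpretable embQ (\<circ>) \<and> wmso_Q_interpretable endQ (\<circ>)"
proof -
  have "embQ \<subseteq> endQ" using embQ_iff endQ_iff strict_mono_mono by blast
  then show ?thesis
    using between_embQ_endQ.wmso_Q_interpretable_between[of embQ]
      between_embQ_endQ.wmso_Q_interpretable_between[of endQ]
    by (simp add: between_embQ_endQ_def)
qed

end
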